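(* Let $(\Omega,\mathcal F,\mathsf P)$ be a probability space, let $p\in(0,1)$, and let $B_1,B_2,\dots$ be an infinite sequence of independent events in $\mathcal F$ such that $\mathsf P(B_i)=p$ for all $i\in\mathbb N=\{1,2,\dots\}$. Let $s$ and $t$ be any two nonnegative integers, let $A\in\mathcal F$ be an event, and suppose that for some $q\in(0,1)$ $$\frac1{N_{n,s,t}}\sum_{(S,T)\in\mathcal P_{n,s,t}}\mathsf P(A\mid B^{S,T})\to q\quad\text{as } n\to\infty .$$ Then $\mathsf P(A)=q$.
   Context: An event is a member of the $\sigma$-algebra $\mathcal F$. Independence of the sequence $(B_i)_{i\in\mathbb N}$ means mutual independence. $\mathsf P(A\mid B)=\mathsf P(A\cap B)/\mathsf P(B)$ for events $A,B$ with $\mathsf P(B)>0$. For any subsets $K,L$ of $\mathbb N$, let $$B^{K,L}:=\Big(\bigcap_{k\in K}B_k\Big)\cap\Big(\bigcap_{l\in L}B_l^{\mathsf c}\Big),$$ where $^{\mathsf c}$ denotes the complement in $\Omega$ and the intersection of an empty family of events is $\Omega$. For $n\in\mathbb N$, $[n]:=\{1,\dots,n\}$. For a set $E$ and a nonnegative integer $k$, $\binom Ek$ denotes the set of all subsets of $E$ of cardinality $k$. For nonnegative integers $s,t$ and any integer $n\ge s+t$, let $$\mathcal P_{n,s,t}:=\Big\{(S,T)\colon S\in\tbinom{[n]}s,\ T\in\tbinom{[n]}t,\ S\cap T=\emptyset\Big\},\qquad N_{n,s,t}:=|\mathcal P_{n,s,t}|=\frac{n!}{s!\,t!\,(n-s-t)!},$$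 where $|\cdot|$ denotes the cardinality. *)

theory Defs
  imports "HOL-Probability.Probability"
begin

(* The explicit "space M" makes the intersection of an empty family the sample space, since HOL's
   empty intersection is UNIV. *)
definition B_cell :: "'a measure \<Rightarrow> (nat \<Rightarrow> 'a set) \<Rightarrow> nat set \<Rightarrow> nat set \<Rightarrow> 'a set" where
  "B_cell M B K L = space M \<inter> (\<Inter>k\<in>K. B k) \<inter> (\<Inter>l\<in>L. space M - B l)"

definition pairs_nst :: "nat \<Rightarrow> nat \<Rightarrow> nat \<Rightarrow> (nat set \<times> nat set) set" where
  "pairs_nst n s t = {(S, T). S \<subseteq> {1..n} \<and> card S = s \<and> T \<subseteq> {1..n} \<and> card T = t \<and> S \<inter> T = {}}"

definition N_nst :: "nat \<Rightarrow> nat \<Rightarrow> nat \<Rightarrow> nat" where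
  "N_nst n s t = card (pairs_nst n s t)"

lemma N_nst_eq_fact:
  assumes "s + t \<le> n"
  shows "real (N_nst n s t) = fact n / (fact s * fact t * fact (n - s - t))"
proof -
  let ?F = "\<lambda>S. {T. T \<subseteq> {1..n} - S \<and> card T = t}"
  let ?A = "{S. S \<subseteq> {1..n} \<and> card S = s}"
  have P: "pairs_nst n s t = Sigma ?A ?F"
    by (auto simp: pairs_nst_def)
  have fin: "finite ?A"
    by (rule finite_subset[of _ "Pow {1..n}"]) auto
  have finF: "finite (?F S)" for S
    by (rule finite_subset[of _ "Pow {1..n}"]) auto
  have cF: "card (?F S) = (n - s) choose t" if "S \<in> ?A" for S
  proof -
    have "finite S" using that finite_subset by auto
    then have "card ({1..n} - S) = n - s"
      using that by (simp add: card_Diff_subset)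
    then show ?thesis using n_subsets[of "{1..n} - S" t] by simp
  qed
  have "N_nst n s t = (\<Sum>S\<in>?A. card (?F S))"
    unfolding N_nst_def P using fin finF by (simp add: card_SigmaI)
  also have "\<dots> = (\<Sum>S\<in>?A. (n - s) choose t)"
    by (rule sum.cong[OF refl]) (rule cF)
  also have "\<dots> = (n choose s) * ((n - s) choose t)"
    using n_subsets[of "{1..n}" s] by simp
  finally show ?thesis
    using assms binomial_fact[of s n, where 'a=real] binomial_fact[of t "n - s", where 'a=real]
    by simp
qed

end

theory Submission
  imports Defs "HOL-Real_Asymp.Real_Asymp"
begin

text \<open>
  The theorem is a weak law of large numbers for the cells. Fix \<open>n\<close> and let the cells
  \<open>C\<close> range over the \<open>B_cell M B S T\<close> with \<open>(S, T)\<close> in \<open>pairs_nst n s t\<close>. They all have the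
  same probability \<open>c = p\<^sup>s (1 - p)\<^sup>t > 0\<close>, so the given average of conditional probabilities is
  \<open>1/c\<close> times the expectation over \<open>A\<close> of the average of the cell indicators. By the
  Cauchy-Schwarz inequality its squared distance to \<open>measure M A\<close> is at most \<open>1/c\<^sup>2\<close> times the
  variance of that average (\<open>sum_prob_Int_deviation\<close>).

  The variance is the average of all pairwise covariances. Two cells with disjoint sets of
  indices are uncorrelated (\<open>prob_B_cell_Int\<close>), and a covariance is at most \<open>1\<close>, so the
  variance is at most the proportion of pairs of cells that share an index. A given cell
  involves only \<open>s + t\<close> indices, and among \<open>n\<close> indices almost every choice of \<open>(S, T)\<close> avoids
  them when \<open>n\<close> is large (\<open>card_disjoint_pairs\<close>, \<open>binomial_shift_ratio_tendsto_1\<close>). Hence the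
  averages converge to \<open>measure M A\<close> for every event \<open>A\<close>, and the theorem follows from the
  uniqueness of limits.
\<close>

section \<open>Averages over equiprobable events\<close>

text \<open>
  The left side is the square of the expectation of \<open>indicator A * X\<close>, where \<open>X\<close> is the sum of
  the centred indicators of the \<open>C i\<close>; the right side is the expectation of \<open>X\<^sup>2\<close>. The inequality
  between them is Cauchy-Schwarz, obtained here from the nonnegativity of the variance of
  \<open>indicator A * X\<close>.
\<close>

lemma (in prob_space) sum_prob_Int_deviation:
  assumes I: "finite I"
    and C: "\<And>i. i \<in> I \<Longrightarrow> C i \<in> events" "\<And>i. i \<in> I \<Longrightarrow> prob (C i) = c"
    and A: "A \<in> events"
  shows "(\<Sum>i\<in>I. prob (A \<inter> C i) - c * prob A)\<^sup>2
    \<le> (\<Sum>i\<in>I. \<Sum>j\<in>I. prob (C i \<inter> C j) - c\<^sup>2)"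
proof -
  define X where "X \<omega> = (\<Sum>i\<in>I. indicat_real (C i) \<omega> - c)" for \<omega>
  define Z where "Z \<omega> = indicat_real A \<omega> * X \<omega>" for \<omega>
  have int_ind: "integrable M (indicat_real E)" if "E \<in> events" for E
    using that by (simp add: emeasure_eq_measure)
  have exp_ind: "expectation (indicat_real E) = prob E" if "E \<in> events" for E
    using that by simp
  have Z_eq: "Z = (\<lambda>\<omega>. \<Sum>i\<in>I. indicat_real (A \<inter> C i) \<omega> - c * indicat_real A \<omega>)"
    by (auto simp: Z_def X_def fun_eq_iff sum_distrib_left indicator_inter_arith algebra_simps)
  have X2_eq: "(\<lambda>\<omega>. (X \<omega>)\<^sup>2) = (\<lambda>\<omega>. \<Sum>i\<in>I. \<Sum>j\<in>I.
      indicat_real (C i \<inter> C j) \<omega> - c * indicat_real (C i) \<omega> - c * indicat_real (C j) \<omega> + c\<^sup>2)"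
    unfolding X_def power2_eq_square sum_product
    by (auto simp: fun_eq_iff indicator_inter_arith algebra_simps)
  have X2_int: "integrable M (\<lambda>\<omega>. (X \<omega>)\<^sup>2)"
    unfolding X2_eq using C(1)
    by (intro Bochner_Integration.integrable_sum Bochner_Integration.integrable_add
        Bochner_Integration.integrable_diff integrable_mult_right int_ind) auto
  have X2_exp: "expectation (\<lambda>\<omega>. (X \<omega>)\<^sup>2) = (\<Sum>i\<in>I. \<Sum>j\<in>I. prob (C i \<inter> C j) - c\<^sup>2)"
  proof -
    let ?f = "\<lambda>i j \<omega>. indicat_real (C i \<inter> C j) \<omega> - c * indicat_real (C i) \<omega>
        - c * indicat_real (C j) \<omega> + c\<^sup>2"
    have f_int: "integrable M (?f i j)" if "i \<in> I" "j \<in> I" for i j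
      using that C(1)
      by (intro Bochner_Integration.integrable_add
          Bochner_Integration.integrable_diff integrable_mult_right int_ind) auto
    have f_exp: "expectation (?f i j) = prob (C i \<inter> C j) - c\<^sup>2" if "i \<in> I" "j \<in> I" for i j
      using that C int_ind by (simp add: prob_space power2_eq_square sets.Int)
    have "expectation (\<lambda>\<omega>. \<Sum>i\<in>I. \<Sum>j\<in>I. ?f i j \<omega>) = (\<Sum>i\<in>I. expectation (\<lambda>\<omega>. \<Sum>j\<in>I. ?f i j \<omega>))"
      by (intro Bochner_Integration.integral_sum Bochner_Integration.integrable_sum f_int)
    also have "\<dots> = (\<Sum>i\<in>I. \<Sum>j\<in>I. expectation (?f i j))"
      by (intro sum.cong refl Bochner_Integration.integral_sum f_int)
    also have "\<dots> = (\<Sum>i\<in>I. \<Sum>j\<in>I. prob (C i \<inter> C j) - c\<^sup>2)"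
      by (intro sum.cong refl f_exp)
    finally show ?thesis unfolding X2_eq .
  qed
  have Z_int: "integrable M Z"
    unfolding Z_eq using C(1) A
    by (intro Bochner_Integration.integrable_sum Bochner_Integration.integrable_diff
        integrable_mult_right int_ind) auto
  have Z_exp: "expectation Z = (\<Sum>i\<in>I. prob (A \<inter> C i) - c * prob A)"
    unfolding Z_eq using C(1) A int_ind
    by (subst Bochner_Integration.integral_sum) (auto intro!: sum.cong)
  have Z2_eq: "(Z \<omega>)\<^sup>2 = indicat_real A \<omega> * (X \<omega>)\<^sup>2" for \<omega>
    by (simp add: Z_def power_mult_distrib indicator_def)
  have Z2_int: "integrable M (\<lambda>\<omega>. (Z \<omega>)\<^sup>2)"
    unfolding Z2_eq using X2_int A integrable_real_mult_indicator[of A M "\<lambda>\<omega>. (X \<omega>)\<^sup>2"]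
    by (simp add: mult.commute)
  have "(expectation Z)\<^sup>2 \<le> expectation (\<lambda>\<omega>. (Z \<omega>)\<^sup>2)"
    using variance_eq[OF Z_int Z2_int] variance_positive[of Z] by simp
  also have "\<dots> \<le> expectation (\<lambda>\<omega>. (X \<omega>)\<^sup>2)"
    by (intro integral_mono Z2_int X2_int) (simp add: Z2_eq indicator_def)
  finally show ?thesis
    unfolding Z_exp X2_exp .
qed

section \<open>Probabilities of cells\<close>

lemma B_cell_Int: "B_cell M B S T \<inter> B_cell M B S' T' = B_cell M B (S \<union> S') (T \<union> T')"
  by (auto simp: B_cell_def)

lemma B_cell_insert_compl: "B_cell M B S (insert l T) = B_cell M B S T - B_cell M B (insert l S) T"
  by (auto simp: B_cell_def)

lemma sets_B_cell:
  assumes "\<And>i. i \<in> S \<union> T \<Longrightarrow> B i \<in> sets M" "finite S" "finite T"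
  shows "B_cell M B S T \<in> sets M"
  using assms(3,2,1)
proof (induction T arbitrary: S)
  case empty
  then show ?case
    by (induction S) (auto simp: B_cell_def Int_assoc Int_left_commute)
next
  case (insert l T)
  then show ?case
    unfolding B_cell_insert_compl by (intro sets.Diff) auto
qed

text \<open>
  Independence is defined through intersections of the events themselves. A complement is
  traded for such intersections by the identity \<open>B_cell_insert_compl\<close>, which on the level of
  probabilities reads \<open>p\<^sup>s (1 - p)\<^sup>t - p\<^sup>s\<^sup>+\<^sup>1 (1 - p)\<^sup>t = p\<^sup>s (1 - p)\<^sup>t\<^sup>+\<^sup>1\<close>.
\<close>

lemma (in prob_space) prob_B_cell:
  assumes indep: "indep_events B J" and p: "\<And>i. i \<in> J \<Longrightarrow> prob (B i) = p"
    and "finite S" "finite T" "S \<subseteq> J" "T \<subseteq> J" "S \<inter> T = {}"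
  shows "prob (B_cell M B S T) = p ^ card S * (1 - p) ^ card T"
  using assms(4,3,5-7)
proof (induction T arbitrary: S)
  case empty
  have B: "B i \<in> events" if "i \<in> S" for i
    using indep that empty by (auto simp: indep_events_def)
  show ?case
  proof (cases "S = {}")
    case True
    then show ?thesis by (simp add: B_cell_def prob_space)
  next
    case False
    then have "B_cell M B S {} = (\<Inter>i\<in>S. B i)"
      using sets.sets_into_space[OF B] by (auto simp: B_cell_def)
    moreover have "prob (\<Inter>i\<in>S. B i) = (\<Prod>i\<in>S. prob (B i))"
      using indep empty False by (auto simp: indep_events_def)
    moreover have "\<dots> = (\<Prod>i\<in>S. p)"
      using empty p by (intro prod.cong) auto
    ultimately show ?thesis by simp
  qed
next
  case (insert l T)
  have ev: "B i \<in> events" if "i \<in> J" for i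
    using indep that by (auto simp: indep_events_def)
  have "prob (B_cell M B S (insert l T)) = prob (B_cell M B S T) - prob (B_cell M B (insert l S) T)"
    unfolding B_cell_insert_compl using insert.prems insert.hyps ev
    by (intro finite_measure_Diff sets_B_cell) (auto simp: B_cell_def)
  also have "\<dots> = p ^ card S * (1 - p) ^ card T - p ^ Suc (card S) * (1 - p) ^ card T"
    using insert.prems insert.hyps insert.IH[of S] insert.IH[of "insert l S"]
    by (auto simp: card_insert_if)
  finally show ?case
    using insert.hyps by (simp add: algebra_simps)
qed

lemma (in prob_space) prob_B_cell_Int:
  assumes "indep_events B J" "\<And>i. i \<in> J \<Longrightarrow> prob (B i) = p"
    and "finite S" "finite T" "S \<subseteq> J" "T \<subseteq> J" "S \<inter> T = {}"
    and "finite S'" "finite T'" "S' \<subseteq> J" "T' \<subseteq> J" "S' \<inter> T' = {}"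
    and "(S \<union> T) \<inter> (S' \<union> T') = {}"
  shows "prob (B_cell M B S T \<inter> B_cell M B S' T')
    = (p ^ card S * (1 - p) ^ card T) * (p ^ card S' * (1 - p) ^ card T')"
proof -
  have "S \<inter> S' = {}" "T \<inter> T' = {}" using assms(13) by auto
  then have "card (S \<union> S') = card S + card S'" "card (T \<union> T') = card T + card T'"
    using assms by (simp_all add: card_Un_disjoint)
  moreover have "prob (B_cell M B (S \<union> S') (T \<union> T'))
      = p ^ card (S \<union> S') * (1 - p) ^ card (T \<union> T')"
    using assms by (intro prob_B_cell[where J = J]) auto
  ultimately show ?thesis
    by (simp add: B_cell_Int power_add)
qed

section \<open>Counting pairs of disjoint sets\<close>

definition disjoint_pairs :: "'a set \<Rightarrow> nat \<Rightarrow> nat \<Rightarrow> ('a set \<times> 'a set) set" where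
  "disjoint_pairs E s t = {(S, T). S \<subseteq> E \<and> card S = s \<and> T \<subseteq> E \<and> card T = t \<and> S \<inter> T = {}}"

lemma pairs_nst_eq: "pairs_nst n s t = disjoint_pairs {1..n} s t"
  by (simp add: pairs_nst_def disjoint_pairs_def)

lemma finite_disjoint_pairs: "finite E \<Longrightarrow> finite (disjoint_pairs E s t)"
  by (rule finite_subset[of _ "Pow E \<times> Pow E"]) (auto simp: disjoint_pairs_def)

lemma card_disjoint_pairs:
  assumes "finite E"
  shows "card (disjoint_pairs E s t) = (card E choose s) * ((card E - s) choose t)"
proof -
  let ?A = "{S. S \<subseteq> E \<and> card S = s}"
  have eq: "disjoint_pairs E s t = (SIGMA S:?A. {T. T \<subseteq> E - S \<and> card T = t})"
    by (auto simp: disjoint_pairs_def)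
  have "card {T. T \<subseteq> E - S \<and> card T = t} = (card E - s) choose t" if "S \<in> ?A" for S
    using that assms n_subsets[of "E - S" t] by (auto simp: card_Diff_subset finite_subset)
  then show ?thesis
    unfolding eq using assms n_subsets[OF assms, of s] by (subst card_SigmaI) auto
qed

text \<open>
  For \<open>n \<ge> m + k\<close> the quotient is the product of the \<open>k\<close> factors \<open>(n - m - i) / (n - i)\<close>, each of
  which tends to \<open>1\<close>.
\<close>

lemma binomial_shift_ratio_tendsto_1:
  "(\<lambda>n. real ((n - m) choose k) / real (n choose k)) \<longlonglongrightarrow> 1"
proof -
  have "(\<lambda>n. (real n - real m - real i) / (real n - real i)) \<longlonglongrightarrow> 1" for i
    by real_asymp
  then have "(\<lambda>n. \<Prod>i<k. (real n - real m - real i) / (real n - real i)) \<longlonglongrightarrow> (\<Prod>i<k. 1)"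
    by (intro tendsto_prod)
  moreover have "eventually (\<lambda>n. (\<Prod>i<k. (real n - real m - real i) / (real n - real i))
      = real ((n - m) choose k) / real (n choose k)) sequentially"
    using eventually_ge_at_top[of "m + k"]
  proof eventually_elim
    case (elim n)
    have "real ((n - m) choose k) = (\<Prod>i<k. (real n - real m - real i) / real (k - i))"
      using elim by (subst binomial_altdef_of_nat) (auto simp: atLeast0LessThan of_nat_diff intro!: prod.cong)
    moreover have "real (n choose k) = (\<Prod>i<k. (real n - real i) / real (k - i))"
      using elim by (subst binomial_altdef_of_nat) (auto simp: atLeast0LessThan of_nat_diff intro!: prod.cong)
    ultimately show ?case
      by (simp add: prod_dividef[symmetric])
  qed
  ultimately show ?thesis
    using Lim_transform_eventually by fastforce
qed

lemma disjoint_pairs_shift_ratio_tendsto_1: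
  "(\<lambda>n. real (((n - m) choose s) * ((n - m - s) choose t)) / real ((n choose s) * ((n - s) choose t)))
    \<longlonglongrightarrow> 1"
proof -
  have "filterlim (\<lambda>n. n - s) sequentially sequentially"
    by (rule filterlim_minus_const_nat_at_top)
  from filterlim_compose[OF binomial_shift_ratio_tendsto_1[of m t] this]
  have "(\<lambda>n. real ((n - s - m) choose t) / real ((n - s) choose t)) \<longlonglongrightarrow> 1" .
  from tendsto_mult[OF binomial_shift_ratio_tendsto_1[of m s] this]
  show ?thesis
    by (simp add: add.commute)
qed

section \<open>Convergence of the averages\<close>

text \<open>
  For each of the \<open>N\<close> cells, all but \<open>N - N'\<close> of the cells use none of its indices, where \<open>N'\<close>
  counts the pairs inside a set of \<open>n - (s + t)\<close> indices. Only the remaining ones can be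
  correlated with it, so the sum of the covariances is at most \<open>N * (N - N')\<close>.
\<close>

lemma (in prob_space) average_cond_prob_deviation:
  fixes s t n :: nat and p :: real
  defines "N \<equiv> real (N_nst n s t)"
    and "N' \<equiv> real (((n - (s + t)) choose s) * ((n - (s + t) - s) choose t))"
  assumes p: "0 < p" "p < 1"
    and indep: "indep_events B {1..}" and B: "\<And>i. i \<ge> 1 \<Longrightarrow> prob (B i) = p"
    and A: "A \<in> events" and n: "s + t \<le> n"
  shows "(1 / N * (\<Sum>(S, T)\<in>pairs_nst n s t. \<P>(\<omega> in M. \<omega> \<in> A \<bar> \<omega> \<in> B_cell M B S T)) - prob A)\<^sup>2
    \<le> (1 - N' / N) / (p ^ s * (1 - p) ^ t)\<^sup>2"
proof -
  define c where "c = p ^ s * (1 - p) ^ t"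
  define I where "I = pairs_nst n s t"
  define C where "C = (\<lambda>(S, T). B_cell M B S T)"
  have c: "c > 0" using p by (simp add: c_def)
  have finI: "finite I" by (simp add: I_def pairs_nst_eq finite_disjoint_pairs)
  have N_card: "N = real (card I)" by (simp add: N_def N_nst_def I_def)
  have N_pos: "N > 0" using n by (simp add: N_def N_nst_eq_fact)
  have ev: "B i \<in> events" if "i \<ge> 1" for i
    using indep that by (auto simp: indep_events_def)
  have pair: "finite S \<and> finite T \<and> S \<subseteq> {1..} \<and> T \<subseteq> {1..} \<and> S \<inter> T = {} \<and> card S = s \<and> card T = t
      \<and> S \<union> T \<subseteq> {1..n}" if "(S, T) \<in> I" for S T
    using that finite_subset[of S "{1..n}"] finite_subset[of T "{1..n}"]
    by (auto simp: I_def pairs_nst_def)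
  have C_ev: "C x \<in> events" if "x \<in> I" for x
  proof -
    obtain S T where x: "x = (S, T)" by (cases x)
    show ?thesis
      using pair[of S T] that x ev by (auto simp: C_def intro!: sets_B_cell)
  qed
  have C_prob: "prob (C x) = c" if "x \<in> I" for x
  proof -
    obtain S T where x: "x = (S, T)" by (cases x)
    show ?thesis
      using pair[of S T] that x prob_B_cell[OF indep, of p S T] B by (auto simp: C_def c_def)
  qed
  have cov: "(\<Sum>y\<in>I. prob (C x \<inter> C y) - c\<^sup>2) \<le> N - N'" if x: "x \<in> I" for x
  proof -
    obtain S T where ST: "x = (S, T)" by (cases x)
    define G where "G = disjoint_pairs ({1..n} - (S \<union> T)) s t"
    note xp = pair[OF x[unfolded ST]]
    have "card (S \<union> T) = s + t" using xp by (simp add: card_Un_disjoint)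
    then have "card ({1..n} - (S \<union> T)) = n - (s + t)"
      using xp by (subst card_Diff_subset) auto
    then have G_card: "real (card G) = N'"
      by (simp add: G_def card_disjoint_pairs N'_def)
    have G_I: "G \<subseteq> I" by (auto simp: G_def I_def pairs_nst_def disjoint_pairs_def)
    have indep_G: "prob (C x \<inter> C y) - c\<^sup>2 = 0" if y: "y \<in> G" for y
    proof -
      obtain S' T' where ST': "y = (S', T')" by (cases y)
      have "(S', T') \<in> I" using y G_I ST' by auto
      note yp = pair[OF this]
      have "(S \<union> T) \<inter> (S' \<union> T') = {}"
        using y by (auto simp: G_def ST' disjoint_pairs_def)
      then show ?thesis
        using xp yp B prob_B_cell_Int[OF indep, of p S T S' T']
        by (simp add: C_def ST ST' c_def power2_eq_square)
    qed
    have "(\<Sum>y\<in>I. prob (C x \<inter> C y) - c\<^sup>2) = (\<Sum>y\<in>I - G. prob (C x \<inter> C y) - c\<^sup>2)"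
      using finI G_I indep_G by (intro sum.mono_neutral_right) auto
    also have "\<dots> \<le> (\<Sum>y\<in>I - G. 1)"
      using prob_le_1 by (intro sum_mono) (smt (verit) zero_le_power2)
    also have "\<dots> = N - N'"
      using finI G_I G_card card_mono[OF finI G_I] finite_subset[OF G_I finI]
      by (simp add: N_card card_Diff_subset of_nat_diff)
    finally show ?thesis .
  qed
  have avg: "(\<Sum>(S, T)\<in>I. \<P>(\<omega> in M. \<omega> \<in> A \<bar> \<omega> \<in> B_cell M B S T)) = (\<Sum>x\<in>I. prob (A \<inter> C x)) / c"
    unfolding sum_divide_distrib
  proof (intro sum.cong refl)
    fix x assume x: "x \<in> I"
    have "{\<omega> \<in> space M. \<omega> \<in> A \<and> \<omega> \<in> C x} = A \<inter> C x" "{\<omega> \<in> space M. \<omega> \<in> C x} = C x"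
      using sets.sets_into_space[OF A] sets.sets_into_space[OF C_ev[OF x]] by auto
    then have "\<P>(\<omega> in M. \<omega> \<in> A \<bar> \<omega> \<in> C x) = prob (A \<inter> C x) / c"
      by (simp add: cond_prob_def C_prob[OF x])
    then show "(case x of (S, T) \<Rightarrow> \<P>(\<omega> in M. \<omega> \<in> A \<bar> \<omega> \<in> B_cell M B S T)) = prob (A \<inter> C x) / c"
      by (simp add: C_def split: prod.splits)
  qed
  have "(\<Sum>x\<in>I. prob (A \<inter> C x) - c * prob A)\<^sup>2 \<le> (\<Sum>x\<in>I. \<Sum>y\<in>I. prob (C x \<inter> C y) - c\<^sup>2)"
    by (rule sum_prob_Int_deviation[OF finI C_ev C_prob A])
  also have "\<dots> \<le> (\<Sum>x\<in>I. N - N')"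
    by (rule sum_mono[OF cov])
  also have "\<dots> = N * (N - N')"
    by (simp add: N_card)
  finally have bound: "((\<Sum>x\<in>I. prob (A \<inter> C x)) - N * (c * prob A))\<^sup>2 \<le> N * (N - N')"
    by (simp add: sum_subtractf N_card)
  have "1 / N * ((\<Sum>x\<in>I. prob (A \<inter> C x)) / c) - prob A
      = ((\<Sum>x\<in>I. prob (A \<inter> C x)) - N * (c * prob A)) / (N * c)"
    using c N_pos by (simp add: field_simps)
  then have "(1 / N * ((\<Sum>x\<in>I. prob (A \<inter> C x)) / c) - prob A)\<^sup>2
      = ((\<Sum>x\<in>I. prob (A \<inter> C x)) - N * (c * prob A))\<^sup>2 / (N * c)\<^sup>2"
    by (simp add: power_divide)
  also have "\<dots> \<le> N * (N - N') / (N * c)\<^sup>2"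
    by (rule divide_right_mono[OF bound]) simp
  also have "\<dots> = (1 - N' / N) / c\<^sup>2"
    using c N_pos by (simp add: field_simps power2_eq_square)
  finally show ?thesis
    unfolding I_def[symmetric] c_def[symmetric] avg .
qed

theorem theorem3:
  fixes M :: "'a measure" and p q :: real and B :: "nat \<Rightarrow> 'a set" and A :: "'a set"
    and s t :: nat
  assumes "prob_space M"
    and "0 < p" and "p < 1"
    and "prob_space.indep_events M B {1..}"
    and "\<And>i. i \<ge> 1 \<Longrightarrow> measure M (B i) = p"
    and "A \<in> sets M"
    and "0 < q" and "q < 1"
    and "(\<lambda>n. 1 / real (N_nst n s t) *
            (\<Sum>(S, T)\<in>pairs_nst n s t. \<P>(\<omega> in M. \<omega> \<in> A \<bar> \<omega> \<in> B_cell M B S T)))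
         \<longlonglongrightarrow> q"
  shows "measure M A = q"
proof -
  interpret prob_space M by fact
  define a where "a n = 1 / real (N_nst n s t) *
    (\<Sum>(S, T)\<in>pairs_nst n s t. \<P>(\<omega> in M. \<omega> \<in> A \<bar> \<omega> \<in> B_cell M B S T))" for n
  define r where "r n = real (((n - (s + t)) choose s) * ((n - (s + t) - s) choose t))
    / real (N_nst n s t)" for n
  have "r \<longlonglongrightarrow> 1"
    using disjoint_pairs_shift_ratio_tendsto_1[of "s + t" s t]
    by (simp add: r_def[abs_def] N_nst_def pairs_nst_eq card_disjoint_pairs)
  then have "(\<lambda>n. (1 - r n) / (p ^ s * (1 - p) ^ t)\<^sup>2) \<longlonglongrightarrow> (1 - 1) / (p ^ s * (1 - p) ^ t)\<^sup>2"
    using assms(2,3) by (intro tendsto_intros) auto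
  then have lim0: "(\<lambda>n. (1 - r n) / (p ^ s * (1 - p) ^ t)\<^sup>2) \<longlonglongrightarrow> 0"
    by simp
  have bound: "eventually (\<lambda>n. (a n - prob A)\<^sup>2 \<le> (1 - r n) / (p ^ s * (1 - p) ^ t)\<^sup>2) sequentially"
    using eventually_ge_at_top[of "s + t"]
  proof eventually_elim
    case (elim n)
    show ?case
      unfolding a_def r_def by (rule average_cond_prob_deviation[OF assms(2-6) elim])
  qed
  have "(\<lambda>n. (a n - prob A)\<^sup>2) \<longlonglongrightarrow> 0"
    by (rule tendsto_sandwich[OF _ bound tendsto_const lim0]) simp
  moreover have "(\<lambda>n. (a n - prob A)\<^sup>2) \<longlonglongrightarrow> (q - prob A)\<^sup>2"
    using assms(9) unfolding a_def by (intro tendsto_intros)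
  ultimately have "(q - prob A)\<^sup>2 = 0"
    by (rule LIMSEQ_unique[symmetric])
  then show ?thesis by simp
qed

end
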